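(* Let $n\geq 3$, let $X$ and $Y$ be two real $n$-normed spaces, and let $\phi\colon X\to Y$ be a (not necessarily surjective) map such that \[ \|x_1,\dots,x_n\| = \|\phi(x_1),\dots,\phi(x_n)\| \qquad \text{for all } x_1,\dots,x_n\in X . \] Then $\phi$ is plus-minus linear, i.e. there exists a function $\epsilon\colon X\to\{-1,1\}$ such that the map $x\mapsto \epsilon(x)\phi(x)$ is a linear transformation from $X$ to $Y$.
   Context: A (real) $n$-normed space is a real vector space $X$ with $\dim X\geq n$ (possibly infinite-dimensional) together with a function $\|\cdot,\dots,\cdot\|\colon X^n\to[0,\infty)$ (an $n$-norm) such that for all $x_1,\dots,x_n,\widetilde x_1\in X$: (1) $\|x_1,\dots,x_n\|=0$ if and only if $x_1,\dots,x_n$ are linearly dependent; (2) $\|x_1,\dots,x_n\|=\|x_{\sigma(1)},\dots,x_{\sigma(n)}\|$ for every permutation $\sigma\in S_n$; (3) $\|\alpha x_1,x_2,\dots,x_n\|=|\alpha|\,\|x_1,x_2,\dots,x_n\|$ for every $\alpha\in\mathbb{R}$; (4) $\|x_1+\widetilde x_1,x_2,\dots,x_n\|\leq\|x_1,x_2,\dots,x_n\|+\|\widetilde x_1,x_2,\dots,x_n\|$. The $n$-norms on $X$ and on $Y$ are denoted by the same symbol. *)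

theory Defs
  imports Complex_Main "HOL-Combinatorics.Permutations"
begin

(* The n-tuples of vectors are the lists of length n.  A tuple is linearly dependent as a family,
   so one with a repeated entry is dependent even when its set of entries is not. *)
definition lin_dependent :: "'a::real_vector list \<Rightarrow> bool" where
  "lin_dependent xs \<longleftrightarrow> \<not> distinct xs \<or> dependent (set xs)"

(* The values of nnorm on lists of length other than n are irrelevant.
   The dimension condition avoids "dim", which is 0 on infinite-dimensional spaces. *)
locale n_normed_space =
  fixes n :: nat and nnorm :: "'a::real_vector list \<Rightarrow> real"
  assumes dim_ge: "\<exists>B::'a set. finite B \<and> card B = n \<and> independent B"
    and nnorm_nonneg: "length xs = n \<Longrightarrow> 0 \<le> nnorm xs"
    and nnorm_eq_0_iff: "length xs = n \<Longrightarrow> nnorm xs = 0 \<longleftrightarrow> lin_dependent xs"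
    and nnorm_permute:
      "length xs = n \<Longrightarrow> \<sigma> permutes {..<n} \<Longrightarrow> nnorm xs = nnorm (permute_list \<sigma> xs)"
    and nnorm_scaleR:
      "length (x # xs) = n \<Longrightarrow> nnorm ((\<alpha> *\<^sub>R x) # xs) = \<bar>\<alpha>\<bar> * nnorm (x # xs)"
    and nnorm_triangle:
      "length (x # xs) = n \<Longrightarrow> nnorm ((x + x') # xs) \<le> nnorm (x # xs) + nnorm (x' # xs)"

definition plus_minus_linear :: "('a::real_vector \<Rightarrow> 'b::real_vector) \<Rightarrow> bool" where
  "plus_minus_linear \<phi> \<longleftrightarrow>
    (\<exists>\<epsilon> :: 'a \<Rightarrow> real. (\<forall>x. \<epsilon> x \<in> {-1, 1}) \<and> linear (\<lambda>x. \<epsilon> x *\<^sub>R \<phi> x))"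

end

theory Submission
  imports Defs
begin

text \<open>
  The zero set of the n-norm consists of the dependent tuples, so \<open>\<phi>\<close> preserves linear
  dependence and independence of n-tuples. Completing shorter tuples to independent n-tuples shows
  that \<open>\<phi>\<close> maps the span of fewer than \<open>n\<close> independent vectors into the span of their
  images (\<open>span_map\<close>). Hence \<open>\<phi> (\<alpha> x)\<close> is a multiple of \<open>\<phi> x\<close>, and, as
  \<open>n \<ge> 3\<close>, \<open>\<phi> (x + y)\<close> is a combination of \<open>\<phi> x\<close> and \<open>\<phi> y\<close> for independent
  \<open>x, y\<close>. The values of the n-norm determine the absolute values of the coefficients:
  \<open>\<phi> (\<alpha> x) = \<plusminus>\<alpha> \<phi> x\<close> and \<open>\<phi> (x + y) = \<plusminus>\<phi> x \<plusminus> \<phi> y\<close>.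

  It remains to choose the signs coherently. Fix a vector \<open>e \<noteq> 0\<close>. For each \<open>x\<close> off the line
  of \<open>e\<close> let \<open>g x\<close> be the one of \<open>\<plusminus>\<phi> x\<close> with
  \<open>\<phi> (e + x) = \<plusminus>(\<phi> e + g x)\<close>, and put \<open>g (c e) = c \<phi> e\<close> on the line. If \<open>e, x, y\<close>
  are independent, then \<open>\<phi> (e + x + y)\<close> is, up to sign, \<open>\<phi> e + g (x + y)\<close>; splitting
  the sum as \<open>(e + x) + y\<close> shows that in it \<open>\<phi> e\<close> and \<open>g x\<close> have equal coefficients, and
  splitting it as \<open>(e + y) + x\<close> shows the same for \<open>\<phi> e\<close> and \<open>g y\<close>. Thus
  \<open>g (x + y) = g x + g y\<close> (\<open>add_independent\<close>). Homogeneity (\<open>scale\<close>) and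
  additivity along \<open>e\<close> (\<open>add_multiple\<close>) follow by splitting further
  sums in two ways and comparing coefficients, because \<open>\<bar>c\<bar> = \<bar>\<alpha>\<bar>\<close> and \<open>\<bar>1 + c\<bar> = \<bar>1 + \<alpha>\<bar>\<close> force
  \<open>c = \<alpha>\<close>. These three facts cover all pairs of vectors, so \<open>g\<close> is linear.
\<close>

section \<open>Independent families\<close>

abbreviation lin_independent :: "'a::real_vector list \<Rightarrow> bool" where
  "lin_independent xs \<equiv> \<not> lin_dependent xs"

lemma lin_independent_Nil: "lin_independent []"
  by (simp add: lin_dependent_def independent_empty)

lemma lin_independent_Cons:
  "lin_independent (x # xs) \<longleftrightarrow> lin_independent xs \<and> x \<notin> span (set xs)"
  by (auto simp: lin_dependent_def independent_insert span_base)

lemma lin_independent_subset: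
  assumes "lin_independent xs" "distinct ys" "set ys \<subseteq> set xs"
  shows "lin_independent ys"
  using assms independent_mono by (auto simp: lin_dependent_def)

lemma lin_independent_two_iff:
  "lin_independent [x, y] \<longleftrightarrow> (\<forall>r s. r *\<^sub>R x + s *\<^sub>R y = 0 \<longrightarrow> r = 0 \<and> s = 0)"
    (is "?L \<longleftrightarrow> ?R")
proof
  assume ?L
  then have y: "y \<noteq> 0" and x: "\<And>k. x \<noteq> k *\<^sub>R y"
    by (auto simp: lin_independent_Cons span_singleton)
  show ?R
  proof (intro allI impI)
    fix r s assume eq: "r *\<^sub>R x + s *\<^sub>R y = 0"
    have "r = 0"
    proof (rule ccontr)
      assume r: "r \<noteq> 0"
      have "x = (1/r) *\<^sub>R (r *\<^sub>R x)" using r by simp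
      also have "r *\<^sub>R x = - (s *\<^sub>R y)" using eq by (simp add: eq_neg_iff_add_eq_0)
      finally have "x = (- s/r) *\<^sub>R y" by simp
      with x show False by blast
    qed
    with eq y show "r = 0 \<and> s = 0" by simp
  qed
next
  assume R: ?R
  have "y \<noteq> 0" using R[rule_format, of 0 1] by auto
  moreover have "x \<noteq> k *\<^sub>R y" for k using R[rule_format, of 1 "- k"] by auto
  ultimately show ?L by (auto simp: lin_independent_Cons lin_independent_Nil span_singleton)
qed

lemma lin_independent_three_iff:
  "lin_independent [x, y, z] \<longleftrightarrow>
    (\<forall>r s t. r *\<^sub>R x + s *\<^sub>R y + t *\<^sub>R z = 0 \<longrightarrow> r = 0 \<and> s = 0 \<and> t = 0)" (is "?L \<longleftrightarrow> ?R")
proof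
  assume ?L
  then have yz: "lin_independent [y, z]" and x: "x \<notin> span {y, z}"
    using lin_independent_Cons[of x "[y, z]"] by auto
  show ?R
  proof (intro allI impI)
    fix r s t assume eq: "r *\<^sub>R x + s *\<^sub>R y + t *\<^sub>R z = 0"
    have "r = 0"
    proof (rule ccontr)
      assume r: "r \<noteq> 0"
      have "x = (1/r) *\<^sub>R (r *\<^sub>R x)" using r by simp
      also have "r *\<^sub>R x = (- s) *\<^sub>R y + (- t) *\<^sub>R z"
        using eq by (simp add: algebra_simps eq_neg_iff_add_eq_0)
      also have "(1/r) *\<^sub>R \<dots> \<in> span {y, z}"
        by (intro span_scale span_add span_base) auto
      finally show False using x by blast
    qed
    with eq yz show "r = 0 \<and> s = 0 \<and> t = 0" by (simp add: lin_independent_two_iff)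
  qed
next
  assume R: ?R
  have "lin_independent [y, z]"
    using R[rule_format, of 0] by (auto simp: lin_independent_two_iff)
  moreover have "x \<notin> span {y, z}"
  proof
    assume "x \<in> span {y, z}"
    then obtain k l where "x - k *\<^sub>R y = l *\<^sub>R z"
      by (auto simp: span_breakdown_eq span_singleton)
    then show False using R[rule_format, of 1 "- k" "- l"] by (simp add: algebra_simps)
  qed
  ultimately show ?L using lin_independent_Cons[of x "[y, z]"] by auto
qed

lemma lin_independent_three_eqD:
  assumes "lin_independent [x, y, z]"
    and "a *\<^sub>R x + b *\<^sub>R y + c *\<^sub>R z = a' *\<^sub>R x + b' *\<^sub>R y + c' *\<^sub>R z"
  shows "a = a'" "b = b'" "c = c'"
  using assms(1)[unfolded lin_independent_three_iff, rule_format, of "a - a'" "b - b'" "c - c'"]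
    assms(2)
  by (simp_all add: algebra_simps)

lemma lin_independent_threeD:
  assumes "lin_independent [x, y, z]"
  shows "lin_independent [x, y]" "lin_independent [x, z]" "lin_independent [y, z]"
  by (rule lin_independent_subset[OF assms]; use assms in \<open>auto simp: lin_dependent_def\<close>)+

section \<open>Additivity up to sign\<close>

text \<open>
  A map that is linear up to signs, with the sign of its value at each vector normalized against a
  reference vector \<open>e\<close>. The last two assumptions are the normalization; the others survive any
  change of signs of the values of \<open>g\<close>. The goal is that such a map is linear.
\<close>

locale signed_additive =
  fixes g :: "'a::real_vector \<Rightarrow> 'b::real_vector" and e :: 'a
  assumes signed_scale: "\<exists>c. \<bar>c\<bar> = \<bar>\<alpha>\<bar> \<and> g (\<alpha> *\<^sub>R x) = c *\<^sub>R g x"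
    and signed_add: "lin_independent [x, y] \<Longrightarrow>
      \<exists>p q. \<bar>p\<bar> = 1 \<and> \<bar>q\<bar> = 1 \<and> g (x + y) = p *\<^sub>R g x + q *\<^sub>R g y"
    and indep_image: "lin_independent [x, y, z] \<Longrightarrow> lin_independent [g x, g y, g z]"
    and indep_extend: "lin_independent [x, y] \<Longrightarrow> \<exists>z. lin_independent [x, y, z]"
    and e_nonzero: "e \<noteq> 0"
    and scale_e: "g (\<alpha> *\<^sub>R e) = \<alpha> *\<^sub>R g e"
    and add_e: "lin_independent [e, x] \<Longrightarrow> \<exists>a. \<bar>a\<bar> = 1 \<and> g (e + x) = a *\<^sub>R (g e + g x)"
begin

lemma g_zero: "g 0 = 0"
  using scale_e[of 0] by simp

text \<open>
  Up to sign, the value at \<open>e + x + y\<close> is computed in three ways. The normalization at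
  \<open>x + y\<close> gives \<open>g e + p g x + q g y\<close>, the normalization at \<open>x\<close> gives
  \<open>g e + g x \<plusminus> g y\<close>, and that at \<open>y\<close> gives \<open>g e \<plusminus> g x + g y\<close>. As
  \<open>g e, g x, g y\<close> are independent, \<open>p = q = 1\<close>.
\<close>

lemma add_independent:
  assumes exy: "lin_independent [e, x, y]"
  shows "g (x + y) = g x + g y"
proof -
  note D = exy[unfolded lin_independent_three_iff, rule_format]
  have e_xy: "lin_independent [e, x + y]" unfolding lin_independent_two_iff
  proof (intro allI impI)
    fix r s assume "r *\<^sub>R e + s *\<^sub>R (x + y) = 0"
    with D[of r s s] show "r = 0 \<and> s = 0" by (auto simp: algebra_simps)
  qed
  have ex_y: "lin_independent [e + x, y]" unfolding lin_independent_two_iff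
  proof (intro allI impI)
    fix r s assume "r *\<^sub>R (e + x) + s *\<^sub>R y = 0"
    with D[of r r s] show "r = 0 \<and> s = 0" by (auto simp: algebra_simps)
  qed
  have ey_x: "lin_independent [e + y, x]" unfolding lin_independent_two_iff
  proof (intro allI impI)
    fix r s assume "r *\<^sub>R (e + y) + s *\<^sub>R x = 0"
    with D[of r s r] show "r = 0 \<and> s = 0" by (auto simp: algebra_simps)
  qed
  obtain p q where pq: "g (x + y) = p *\<^sub>R g x + q *\<^sub>R g y"
    using signed_add[OF lin_independent_threeD(3)[OF exy]] by blast
  obtain a where a: "\<bar>a\<bar> = 1" "g (e + (x + y)) = a *\<^sub>R (g e + g (x + y))"
    using add_e[OF e_xy] by blast
  obtain b where b: "g (e + x) = b *\<^sub>R (g e + g x)"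
    using add_e[OF lin_independent_threeD(1)[OF exy]] by blast
  obtain c where c: "g (e + y) = c *\<^sub>R (g e + g y)"
    using add_e[OF lin_independent_threeD(2)[OF exy]] by blast
  obtain b1 b2 where b12: "g (e + x + y) = b1 *\<^sub>R g (e + x) + b2 *\<^sub>R g y"
    using signed_add[OF ex_y] by blast
  obtain c1 c2 where c12: "g (e + y + x) = c1 *\<^sub>R g (e + y) + c2 *\<^sub>R g x"
    using signed_add[OF ey_x] by blast
  have "a *\<^sub>R g e + (a * p) *\<^sub>R g x + (a * q) *\<^sub>R g y
      = (b1 * b) *\<^sub>R g e + (b1 * b) *\<^sub>R g x + b2 *\<^sub>R g y"
    using a(2) b12 b pq by (simp add: algebra_simps)
  from lin_independent_three_eqD[OF indep_image[OF exy] this] have "a * p = a" by simp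
  moreover
  have "a *\<^sub>R g e + (a * p) *\<^sub>R g x + (a * q) *\<^sub>R g y
      = (c1 * c) *\<^sub>R g e + c2 *\<^sub>R g x + (c1 * c) *\<^sub>R g y"
    using a(2) c12 c pq by (simp add: algebra_simps)
  from lin_independent_three_eqD[OF indep_image[OF exy] this] have "a * q = a" by simp
  ultimately have "p = 1" "q = 1" using a(1) by auto
  with pq show ?thesis by simp
qed

text \<open>
  With \<open>g (\<alpha> x) = c g x\<close>, an auxiliary vector \<open>y\<close> off the plane of \<open>e\<close> and
  \<open>x\<close> makes \<open>add_independent\<close> applicable to both splittings \<open>(x + y) + \<alpha> x\<close> and
  \<open>(1 + \<alpha>) x + y\<close> of the same vector. They give \<open>1 + c = \<plusminus>(1 + \<alpha>)\<close>, which for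
  \<open>\<alpha> \<noteq> 0\<close> excludes \<open>c = - \<alpha>\<close>.
\<close>

lemma scale_independent:
  assumes ex: "lin_independent [e, x]" and \<alpha>: "\<alpha> \<noteq> 0"
  shows "g (\<alpha> *\<^sub>R x) = \<alpha> *\<^sub>R g x"
proof -
  obtain y where exy: "lin_independent [e, x, y]" using indep_extend[OF ex] by blast
  note D = exy[unfolded lin_independent_three_iff, rule_format]
  obtain c where c: "\<bar>c\<bar> = \<bar>\<alpha>\<bar>" "g (\<alpha> *\<^sub>R x) = c *\<^sub>R g x" using signed_scale by blast
  have "lin_independent [e, x + y, \<alpha> *\<^sub>R x]" unfolding lin_independent_three_iff
  proof (intro allI impI)
    fix r s t assume "r *\<^sub>R e + s *\<^sub>R (x + y) + t *\<^sub>R \<alpha> *\<^sub>R x = 0"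
    with D[of r "s + t * \<alpha>" s] \<alpha> show "r = 0 \<and> s = 0 \<and> t = 0" by (auto simp: algebra_simps)
  qed
  from add_independent[OF this] add_independent[OF exy]
  have 1: "g ((1 + \<alpha>) *\<^sub>R x + y) = (1 + c) *\<^sub>R g x + g y"
    using c(2) by (simp add: algebra_simps)
  obtain d where d: "\<bar>d\<bar> = \<bar>1 + \<alpha>\<bar>" "g ((1 + \<alpha>) *\<^sub>R x) = d *\<^sub>R g x"
    using signed_scale by blast
  have 2: "g ((1 + \<alpha>) *\<^sub>R x + y) = d *\<^sub>R g x + g y"
  proof (cases "1 + \<alpha> = 0")
    case True
    then show ?thesis using d by simp
  next
    case False
    have "lin_independent [e, (1 + \<alpha>) *\<^sub>R x, y]" unfolding lin_independent_three_iff
    proof (intro allI impI)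
      fix r s t assume "r *\<^sub>R e + s *\<^sub>R (1 + \<alpha>) *\<^sub>R x + t *\<^sub>R y = 0"
      with D[of r "s * (1 + \<alpha>)" t] False show "r = 0 \<and> s = 0 \<and> t = 0" by simp
    qed
    from add_independent[OF this] show ?thesis using d(2) by simp
  qed
  have "0 *\<^sub>R g e + (1 + c) *\<^sub>R g x + 1 *\<^sub>R g y = 0 *\<^sub>R g e + d *\<^sub>R g x + 1 *\<^sub>R g y"
    using trans[OF 1[symmetric] 2] by (simp only: scaleR_zero_left scaleR_one add_0_left)
  from lin_independent_three_eqD(2)[OF indep_image[OF exy] this] c(1) d(1)
  have "c = \<alpha>" by linarith
  with c(2) show ?thesis by simp
qed

text \<open>
  Here \<open>g (x + a e) = p g x + q g e\<close> with \<open>p = \<plusminus>1\<close> and \<open>q = \<plusminus>a\<close>. The coefficient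
  \<open>q\<close> is found from the normalization: \<open>e + (x + a e) = x + (1 + a) e\<close> gives
  \<open>\<bar>1 + q\<bar> = \<bar>1 + a\<bar>\<close>. The coefficient \<open>p\<close> is found by moving \<open>a e\<close> to
  another summand: \<open>(x + a e) + y = x + (y + a e)\<close>, where \<open>g x\<close> has coefficient 1 on the
  right.
\<close>

lemma add_multiple_independent:
  assumes ex: "lin_independent [e, x]"
  shows "g (x + a *\<^sub>R e) = g x + a *\<^sub>R g e"
proof (cases "a = 0")
  case True
  then show ?thesis by simp
next
  case a: False
  note E = ex[unfolded lin_independent_two_iff, rule_format]
  obtain y where exy: "lin_independent [e, x, y]" using indep_extend[OF ex] by blast
  note D = exy[unfolded lin_independent_three_iff, rule_format]
  have shift: "\<exists>p q. \<bar>p\<bar> = 1 \<and> \<bar>q\<bar> = \<bar>b\<bar> \<and> g (z + b *\<^sub>R e) = p *\<^sub>R g z + q *\<^sub>R g e"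
    if ez: "lin_independent [e, z]" for z b
  proof (cases "b = 0")
    case True
    then show ?thesis by (intro exI[of _ 1] exI[of _ 0]) simp
  next
    case False
    have "lin_independent [z, b *\<^sub>R e]" unfolding lin_independent_two_iff
    proof (intro allI impI)
      fix r s assume "r *\<^sub>R z + s *\<^sub>R b *\<^sub>R e = 0"
      with ez[unfolded lin_independent_two_iff, rule_format, of "s * b" r] False
      show "r = 0 \<and> s = 0" by (auto simp: algebra_simps)
    qed
    then obtain p q where "\<bar>p\<bar> = 1" "\<bar>q\<bar> = 1" "g (z + b *\<^sub>R e) = p *\<^sub>R g z + q *\<^sub>R g (b *\<^sub>R e)"
      using signed_add by blast
    then show ?thesis by (intro exI[of _ p] exI[of _ "q * b"]) (simp add: scale_e abs_mult)
  qed
  obtain p q where pq: "\<bar>p\<bar> = 1" "\<bar>q\<bar> = \<bar>a\<bar>" "g (x + a *\<^sub>R e) = p *\<^sub>R g x + q *\<^sub>R g e"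
    using shift[OF ex] by blast
  have "q = a"
  proof -
    have "lin_independent [e, x + a *\<^sub>R e]" unfolding lin_independent_two_iff
    proof (intro allI impI)
      fix r s assume "r *\<^sub>R e + s *\<^sub>R (x + a *\<^sub>R e) = 0"
      with E[of "r + s * a" s] show "r = 0 \<and> s = 0" by (auto simp: algebra_simps)
    qed
    from add_e[OF this] obtain b where
      b: "\<bar>b\<bar> = 1" "g (e + (x + a *\<^sub>R e)) = b *\<^sub>R (g e + g (x + a *\<^sub>R e))" by blast
    obtain p' q' where pq': "\<bar>q'\<bar> = \<bar>1 + a\<bar>" "g (x + (1 + a) *\<^sub>R e) = p' *\<^sub>R g x + q' *\<^sub>R g e"
      using shift[OF ex] by blast
    have "(b * (1 + q)) *\<^sub>R g e + (b * p) *\<^sub>R g x + 0 *\<^sub>R g y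
        = q' *\<^sub>R g e + p' *\<^sub>R g x + 0 *\<^sub>R g y"
      using b(2) pq(3) pq'(2) by (simp add: algebra_simps)
    from lin_independent_three_eqD(1)[OF indep_image[OF exy] this]
    have "\<bar>q'\<bar> = \<bar>1 + q\<bar>" using b(1) abs_mult[of b "1 + q"] by simp
    with pq(2) pq'(1) show "q = a" by linarith
  qed
  moreover have "p = 1"
  proof -
    obtain p' q' where pq': "g (y + a *\<^sub>R e) = p' *\<^sub>R g y + q' *\<^sub>R g e"
      using shift[OF lin_independent_threeD(2)[OF exy]] by blast
    have "lin_independent [e, x + a *\<^sub>R e, y]" unfolding lin_independent_three_iff
    proof (intro allI impI)
      fix r s t assume "r *\<^sub>R e + s *\<^sub>R (x + a *\<^sub>R e) + t *\<^sub>R y = 0"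
      with D[of "r + s * a" s t] show "r = 0 \<and> s = 0 \<and> t = 0" by (auto simp: algebra_simps)
    qed
    moreover have "lin_independent [e, x, y + a *\<^sub>R e]" unfolding lin_independent_three_iff
    proof (intro allI impI)
      fix r s t assume "r *\<^sub>R e + s *\<^sub>R x + t *\<^sub>R (y + a *\<^sub>R e) = 0"
      with D[of "r + t * a" s t] show "r = 0 \<and> s = 0 \<and> t = 0" by (auto simp: algebra_simps)
    qed
    ultimately have "g (x + a *\<^sub>R e) + g y = g x + g (y + a *\<^sub>R e)"
      by (metis add_independent add.assoc add.commute)
    then have "q *\<^sub>R g e + p *\<^sub>R g x + 1 *\<^sub>R g y = q' *\<^sub>R g e + 1 *\<^sub>R g x + p' *\<^sub>R g y"
      using pq(3) pq' by (simp add: algebra_simps)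
    from lin_independent_three_eqD(2)[OF indep_image[OF exy] this] show "p = 1" .
  qed
  ultimately show ?thesis using pq(3) by simp
qed

lemma line_or_independent: "(\<exists>c. x = c *\<^sub>R e) \<or> lin_independent [e, x]"
proof (rule disjCI)
  assume "\<not> lin_independent [e, x]"
  then have "\<not> lin_independent [x, e]"
    using lin_independent_subset[of "[x, e]" "[e, x]"] by (auto simp: lin_dependent_def insert_commute)
  with e_nonzero show "\<exists>c. x = c *\<^sub>R e"
    by (auto simp: lin_independent_Cons lin_independent_Nil span_singleton)
qed

lemma scale: "g (\<alpha> *\<^sub>R x) = \<alpha> *\<^sub>R g x"
  using line_or_independent[of x]
proof
  assume "\<exists>c. x = c *\<^sub>R e"
  then show ?thesis using scale_e by auto
next
  assume "lin_independent [e, x]"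
  then show ?thesis by (cases "\<alpha> = 0") (simp_all add: g_zero scale_independent)
qed

lemma add_multiple: "g (x + a *\<^sub>R e) = g x + a *\<^sub>R g e"
  using line_or_independent[of x]
proof
  assume "\<exists>c. x = c *\<^sub>R e"
  then show ?thesis by (auto simp: scale_e simp flip: scaleR_add_left)
qed (rule add_multiple_independent)

text \<open>
  If \<open>e, x, y\<close> are dependent, then \<open>x\<close> is on the line of \<open>e\<close>, or
  \<open>y = b x + a e\<close>; in both cases the sum reduces to one vector plus a multiple of \<open>e\<close>.
\<close>

lemma linear_g: "linear g"
proof (rule linearI)
  fix x y
  consider c where "x = c *\<^sub>R e" | a b where "y = b *\<^sub>R x + a *\<^sub>R e" | "lin_independent [y, x, e]"
  proof (cases "lin_independent [x, e]")
    case True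
    show ?thesis
    proof (cases "y \<in> span {x, e}")
      case True
      then obtain b a where "y - b *\<^sub>R x = a *\<^sub>R e"
        by (auto simp: span_breakdown_eq span_singleton)
      then show ?thesis using that(2)[of b a] by (simp add: diff_eq_eq add.commute)
    next
      case False
      with \<open>lin_independent [x, e]\<close> show ?thesis
        using that(3) lin_independent_Cons[of y "[x, e]"] by auto
    qed
  next
    case False
    then show ?thesis using that(1) e_nonzero
      by (auto simp: lin_independent_Cons lin_independent_Nil span_singleton)
  qed
  then show "g (x + y) = g x + g y"
  proof cases
    case 1
    then show ?thesis using add_multiple[of y c] by (simp add: scale_e add.commute)
  next
    case 2
    have "g (x + y) = g ((1 + b) *\<^sub>R x + a *\<^sub>R e)" using 2 by (simp add: algebra_simps)
    also have "\<dots> = (1 + b) *\<^sub>R g x + a *\<^sub>R g e" by (simp only: add_multiple scale)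
    also have "\<dots> = g x + g y" by (simp add: 2 add_multiple scale scaleR_add_left)
    finally show ?thesis .
  next
    case 3
    then have "lin_independent [e, x, y]"
      using lin_independent_subset[of "[y, x, e]" "[e, x, y]"] by (auto simp: lin_dependent_def)
    then show ?thesis by (rule add_independent)
  qed
qed (rule scale)

end

section \<open>Maps preserving the n-norm\<close>

context n_normed_space
begin

text \<open>
  This is where the assumption on the dimension enters. A maximal independent set between \<open>xs\<close> and
  its union with \<open>n\<close> independent vectors spans those vectors, hence has at least \<open>n\<close>
  elements, whether or not the whole space is finite-dimensional.
\<close>

lemma lin_independent_extend:
  fixes xs :: "'a list"
  assumes xs: "lin_independent xs" "length xs \<le> n"
  shows "\<exists>zs. length (xs @ zs) = n \<and> lin_independent (xs @ zs)"
proof -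
  obtain B0 :: "'a set" where B0: "finite B0" "card B0 = n" "independent B0"
    using dim_ge by blast
  have S: "independent (set xs)" "distinct xs" using xs by (auto simp: lin_dependent_def)
  obtain B where B: "set xs \<subseteq> B" "B \<subseteq> set xs \<union> B0" "independent B" "set xs \<union> B0 \<subseteq> span B"
    using maximal_independent_subset_extend[of "set xs" "set xs \<union> B0"] S(1) by blast
  have fin: "finite B" using B(2) B0(1) finite_subset by blast
  have "card B0 \<le> card B"
    using independent_span_bound[OF fin B0(3)] B(4) by blast
  then have "n - length xs \<le> card (B - set xs)"
    using B0(2) B(1) S(2) fin by (simp add: card_Diff_subset distinct_card)
  then obtain T where T: "T \<subseteq> B - set xs" "card T = n - length xs" "finite T"
    by (meson obtain_subset_with_card_n)
  obtain zs where zs: "set zs = T" "distinct zs" using finite_distinct_list[OF T(3)] by blast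
  have "length zs = n - length xs" using zs T(2) distinct_card by metis
  moreover have "lin_independent (xs @ zs)"
    using zs T(1) S(2) B independent_mono[OF B(3), of "set xs \<union> T"]
    by (auto simp: lin_dependent_def)
  ultimately show ?thesis using xs(2) by (intro exI[of _ zs]) simp
qed

text \<open>
  A tuple with a repeated vector has norm zero, so by the triangle inequality a shear does not
  increase the norm; the inverse shear gives the reverse inequality.
\<close>

lemma nnorm_shear:
  assumes "length (x # y # zs) = n"
  shows "nnorm ((x + \<alpha> *\<^sub>R y) # y # zs) = nnorm (x # y # zs)"
proof -
  have le: "nnorm ((v + \<beta> *\<^sub>R y) # y # zs) \<le> nnorm (v # y # zs)" for v \<beta>
  proof -
    have "nnorm (y # y # zs) = 0" using assms by (simp add: nnorm_eq_0_iff lin_dependent_def)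
    then have "nnorm ((\<beta> *\<^sub>R y) # y # zs) = 0" using assms by (simp add: nnorm_scaleR)
    then show ?thesis using nnorm_triangle[of v "y # zs" "\<beta> *\<^sub>R y"] assms by simp
  qed
  show ?thesis using le[of x \<alpha>] le[of "x + \<alpha> *\<^sub>R y" "- \<alpha>"] by simp
qed

end

locale n_norm_preserving =
  X: n_normed_space n nnormX + Y: n_normed_space n nnormY
  for n and nnormX :: "'a::real_vector list \<Rightarrow> real" and nnormY :: "'b::real_vector list \<Rightarrow> real" +
  fixes \<phi> :: "'a \<Rightarrow> 'b"
  assumes nnorm_map: "length xs = n \<Longrightarrow> nnormX xs = nnormY (map \<phi> xs)"
begin

lemma lin_dependent_map: "length xs = n \<Longrightarrow> lin_dependent (map \<phi> xs) \<longleftrightarrow> lin_dependent xs"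
  using nnorm_map[of xs] X.nnorm_eq_0_iff[of xs] Y.nnorm_eq_0_iff[of "map \<phi> xs"] by simp

lemma lin_independent_map:
  assumes "lin_independent xs" "length xs \<le> n"
  shows "lin_independent (map \<phi> xs)"
proof -
  obtain zs where "length (xs @ zs) = n" "lin_independent (xs @ zs)"
    using X.lin_independent_extend[OF assms] by blast
  then have "lin_independent (map \<phi> (xs @ zs))" using lin_dependent_map by blast
  then show ?thesis by (rule lin_independent_subset) (use \<open>lin_independent (map \<phi> (xs @ zs))\<close> in
      \<open>auto simp: lin_dependent_def\<close>)
qed

text \<open>
  Complete \<open>xs\<close> to an independent \<open>n\<close>-tuple by \<open>zs\<close>. Replacing any one \<open>b\<close> in
  \<open>zs\<close> by \<open>y\<close> makes the tuple dependent, so \<open>\<phi> y\<close> lies in the span of the images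
  of the other members. Its coordinate at \<open>\<phi> b\<close> therefore vanishes for every \<open>b\<close> in
  \<open>zs\<close>, and only the images of \<open>xs\<close> remain.
\<close>

lemma span_map:
  assumes xs: "lin_independent xs" "length xs < n" and y: "y \<in> span (set xs)"
  shows "\<phi> y \<in> span (\<phi> ` set xs)"
proof -
  obtain zs where zs: "length (xs @ zs) = n" "lin_independent (xs @ zs)"
    using X.lin_independent_extend[OF xs(1)] xs(2) by auto
  define C where "C = \<phi> ` set (xs @ zs)"
  have ind: "lin_independent (map \<phi> (xs @ zs))" using zs lin_dependent_map by blast
  then have C: "independent C" "inj_on \<phi> (set (xs @ zs))"
    unfolding lin_dependent_def C_def distinct_map set_map by blast+
  have omit: "\<phi> y \<in> span (C - {\<phi> b})" if b: "b \<in> set zs" for b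
  proof -
    obtain us vs where uv: "zs = us @ b # vs" using split_list[OF b] by blast
    let ?ws = "xs @ us @ vs"
    have d: "distinct (xs @ zs)" using zs(2) by (simp add: lin_dependent_def)
    then have "distinct ?ws" by (auto simp: uv)
    then have ws: "lin_independent ?ws"
      by (intro lin_independent_subset[OF zs(2)]) (auto simp: uv)
    have len: "length (y # ?ws) = n" using zs(1) uv by simp
    have "y \<in> span (set ?ws)" using y span_mono[of "set xs" "set ?ws"] by auto
    then have "lin_dependent (y # ?ws)" using lin_independent_Cons by blast
    then have "lin_dependent (map \<phi> (y # ?ws))" using lin_dependent_map[OF len] by blast
    moreover have "lin_independent (map \<phi> ?ws)" using lin_independent_map[OF ws] len by simp
    ultimately have "\<phi> y \<in> span (set (map \<phi> ?ws))"
      using lin_independent_Cons[of "\<phi> y" "map \<phi> ?ws"] by auto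
    moreover have "set (map \<phi> ?ws) \<subseteq> C - {\<phi> b}"
    proof -
      have "set ?ws = set (xs @ zs) - {b}" using d by (auto simp: uv)
      then have "set (map \<phi> ?ws) = \<phi> ` (set (xs @ zs) - {b})" by (simp only: set_map)
      also have "\<dots> = C - {\<phi> b}"
        using b inj_on_image_set_diff[OF C(2), of "set (xs @ zs)" "{b}"] by (simp add: C_def)
      finally show ?thesis by simp
    qed
    ultimately show ?thesis using span_mono by blast
  qed
  have zero: "representation C (\<phi> y) (\<phi> b) = 0" if "b \<in> set zs" for b
    using representation_extend[OF C(1) omit[OF that]] representation_ne_zero[of "C - {\<phi> b}" "\<phi> y" "\<phi> b"]
    by fastforce
  \<comment> \<open>Since \<open>xs\<close> has fewer than \<open>n\<close> entries, there is a \<open>b\<close> to omit, and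
    \<open>\<phi> y\<close> does lie in the span of \<open>C\<close>.\<close>
  have "zs \<noteq> []" using zs(1) xs(2) by auto
  then have "\<phi> y \<in> span C" using omit[of "hd zs"] span_mono[of "C - {\<phi> (hd zs)}" C] by auto
  then have "\<phi> y = (\<Sum>b | representation C (\<phi> y) b \<noteq> 0. representation C (\<phi> y) b *\<^sub>R b)"
    using sum_nonzero_representation_eq[OF C(1)] by simp
  also have "\<dots> \<in> span (\<phi> ` set xs)"
  proof (intro span_sum span_scale span_base)
    fix c assume "c \<in> {b. representation C (\<phi> y) b \<noteq> 0}"
    then show "c \<in> \<phi> ` set xs"
      using representation_ne_zero[of C "\<phi> y" c] zero by (auto simp: C_def)
  qed
  finally show ?thesis .
qed

lemma signed_scale_nonzero:
  assumes "x \<noteq> 0" "n \<ge> 2"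
  shows "\<exists>c. \<bar>c\<bar> = \<bar>\<alpha>\<bar> \<and> \<phi> (\<alpha> *\<^sub>R x) = c *\<^sub>R \<phi> x"
proof -
  have x: "lin_independent [x]" using assms by (simp add: lin_independent_Cons lin_independent_Nil)
  obtain c where c: "\<phi> (\<alpha> *\<^sub>R x) = c *\<^sub>R \<phi> x"
    using span_map[OF x, of "\<alpha> *\<^sub>R x"] assms by (auto simp: span_singleton)
  obtain zs where zs: "length (x # zs) = n" "lin_independent (x # zs)"
    using X.lin_independent_extend[OF x] assms by auto
  have "\<bar>\<alpha>\<bar> * nnormX (x # zs) = nnormX ((\<alpha> *\<^sub>R x) # zs)" using zs by (simp add: X.nnorm_scaleR)
  also have "\<dots> = \<bar>c\<bar> * nnormX (x # zs)"
    using zs c nnorm_map[of "(\<alpha> *\<^sub>R x) # zs"] nnorm_map[of "x # zs"] by (simp add: Y.nnorm_scaleR)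
  finally have "\<bar>c\<bar> = \<bar>\<alpha>\<bar>" using zs X.nnorm_eq_0_iff by simp
  with c show ?thesis by blast
qed

text \<open>
  Next to \<open>x\<close> in a tuple, \<open>x + y\<close> can be replaced by \<open>y\<close>, and next to
  \<open>\<phi> x\<close> the image \<open>a \<phi> x + b \<phi> y\<close> can be replaced by \<open>b \<phi> y\<close>. So
  preservation of the norm says that \<open>\<bar>b\<bar>\<close> times a nonzero number is that number.
\<close>

lemma coefficient_abs:
  assumes xy: "lin_independent [y, x]" and n: "n \<ge> 2" and eq: "\<phi> (x + y) = a *\<^sub>R \<phi> x + b *\<^sub>R \<phi> y"
  shows "\<bar>b\<bar> = 1"
proof -
  obtain zs where zs: "length (y # x # zs) = n" "lin_independent (y # x # zs)"
    using X.lin_independent_extend[OF xy] n by auto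
  have "nnormX (y # x # zs) = nnormX ((x + y) # x # zs)"
    using X.nnorm_shear[OF zs(1), of 1] by (simp add: add.commute)
  also have "\<dots> = nnormY ((b *\<^sub>R \<phi> y + a *\<^sub>R \<phi> x) # \<phi> x # map \<phi> zs)"
    using nnorm_map[of "(x + y) # x # zs"] zs eq by (simp add: add.commute)
  also have "\<dots> = \<bar>b\<bar> * nnormX (y # x # zs)"
    using zs Y.nnorm_shear nnorm_map[of "y # x # zs"] by (simp add: Y.nnorm_scaleR)
  finally show ?thesis using zs X.nnorm_eq_0_iff by simp
qed

text \<open>
  For \<open>n = 2\<close> two independent vectors are already an \<open>n\<close>-tuple and \<open>span_map\<close> does
  not apply to them; from \<open>n = 3\<close> on it gives the coefficients \<open>p\<close> and \<open>q\<close>.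
\<close>

lemma signed_add_independent:
  assumes xy: "lin_independent [x, y]" and n: "n \<ge> 3"
  shows "\<exists>p q. \<bar>p\<bar> = 1 \<and> \<bar>q\<bar> = 1 \<and> \<phi> (x + y) = p *\<^sub>R \<phi> x + q *\<^sub>R \<phi> y"
proof -
  have yx: "lin_independent [y, x]"
    using lin_independent_subset[OF xy, of "[y, x]"] xy by (auto simp: lin_dependent_def)
  have "x + y \<in> span (set [x, y])" by (auto intro: span_add span_base)
  from span_map[OF xy _ this] n obtain p q where pq: "\<phi> (x + y) = p *\<^sub>R \<phi> x + q *\<^sub>R \<phi> y"
    by (auto simp: span_breakdown_eq span_singleton diff_eq_eq add.commute)
  then have "\<bar>q\<bar> = 1" "\<bar>p\<bar> = 1"
    using coefficient_abs[OF yx, of p q] coefficient_abs[OF xy, of q p] n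
    by (simp_all add: add.commute)
  with pq show ?thesis by blast
qed

lemma \<phi>_plus_minus_linear:
  assumes n: "n \<ge> 3"
  shows "plus_minus_linear \<phi>"
proof -
  obtain zs :: "'a list" where zs: "length zs = n" "lin_independent zs"
    using X.lin_independent_extend[OF lin_independent_Nil] by auto
  then obtain e es where "zs = e # es" using n by (cases zs) auto
  then have e: "e \<noteq> 0" using zs(2) lin_independent_Cons span_zero by blast
  have zero: "\<phi> 0 = 0" using signed_scale_nonzero[OF e, of 0] n by auto
  have scale: "\<exists>c. \<bar>c\<bar> = \<bar>\<alpha>\<bar> \<and> \<phi> (\<alpha> *\<^sub>R x) = c *\<^sub>R \<phi> x" for \<alpha> x
    using signed_scale_nonzero[of x \<alpha>] n zero by (cases "x = 0") (auto intro: exI[of _ \<alpha>])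
  \<comment> \<open>The choice of signs: if \<open>\<phi> (e + x) = p \<phi> e + q \<phi> x\<close>, then \<open>\<phi> x\<close> is
    given the sign \<open>p q\<close>; on the line of \<open>e\<close> the sign is dictated by homogeneity.\<close>
  have "\<exists>s. \<bar>s\<bar> = 1 \<and> (\<forall>c. x = c *\<^sub>R e \<longrightarrow> s *\<^sub>R \<phi> x = c *\<^sub>R \<phi> e) \<and>
      (lin_independent [e, x] \<longrightarrow> (\<exists>a. \<bar>a\<bar> = 1 \<and> \<phi> (e + x) = a *\<^sub>R (\<phi> e + s *\<^sub>R \<phi> x)))" for x
  proof (cases "\<exists>c. x = c *\<^sub>R e")
    case True
    then obtain c where c: "x = c *\<^sub>R e" by blast
    then obtain d where d: "\<bar>d\<bar> = \<bar>c\<bar>" "\<phi> x = d *\<^sub>R \<phi> e" using scale by blast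
    have dep: "\<not> lin_independent [e, x]"
      using lin_independent_two_iff[THEN iffD1, rule_format, of e x c "- 1"] c by auto
    have uniq: "c' = c" if "x = c' *\<^sub>R e" for c' using that c e by simp
    define s :: real where "s = (if d = c then 1 else - 1)"
    have s: "\<bar>s\<bar> = 1" "s * d = c" using d(1) by (auto simp: s_def abs_eq_iff)
    have "s *\<^sub>R \<phi> x = c *\<^sub>R \<phi> e" using d(2) s(2) by simp
    with s(1) dep uniq show ?thesis by blast
  next
    case False
    show ?thesis
    proof (cases "lin_independent [e, x]")
      case True
      then obtain p q where pq: "\<bar>p\<bar> = 1" "\<bar>q\<bar> = 1" "\<phi> (e + x) = p *\<^sub>R \<phi> e + q *\<^sub>R \<phi> x"
        using signed_add_independent n by blast
      have "p * p = 1" using pq(1) abs_mult_self_eq[of p] by simp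
      then have "\<phi> (e + x) = p *\<^sub>R (\<phi> e + (p * q) *\<^sub>R \<phi> x)"
        using pq(3) by (simp add: scaleR_add_right flip: mult.assoc)
      with pq False show ?thesis by (intro exI[of _ "p * q"]) (auto simp: abs_mult)
    qed (use False in \<open>auto intro: exI[of _ 1]\<close>)
  qed
  then obtain \<epsilon> where \<epsilon>: "\<And>x. \<bar>\<epsilon> x\<bar> = 1" "\<And>c. \<epsilon> (c *\<^sub>R e) *\<^sub>R \<phi> (c *\<^sub>R e) = c *\<^sub>R \<phi> e"
    "\<And>x. lin_independent [e, x] \<Longrightarrow> \<exists>a. \<bar>a\<bar> = 1 \<and> \<phi> (e + x) = a *\<^sub>R (\<phi> e + \<epsilon> x *\<^sub>R \<phi> x)"
    by metis
  have sq: "\<epsilon> x * \<epsilon> x = 1" for x using \<epsilon>(1)[of x] abs_mult_self_eq[of "\<epsilon> x"] by simp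
  define g where "g x = \<epsilon> x *\<^sub>R \<phi> x" for x
  have \<phi>_g: "\<phi> x = \<epsilon> x *\<^sub>R g x" for x by (simp add: g_def sq)
  have ge: "g e = \<phi> e" using \<epsilon>(2)[of 1] by (simp add: g_def)
  interpret signed_additive g e
  proof
    show "\<exists>c. \<bar>c\<bar> = \<bar>\<alpha>\<bar> \<and> g (\<alpha> *\<^sub>R x) = c *\<^sub>R g x" for \<alpha> x
    proof -
      obtain c where "\<bar>c\<bar> = \<bar>\<alpha>\<bar>" "\<phi> (\<alpha> *\<^sub>R x) = c *\<^sub>R \<phi> x" using scale by blast
      then show ?thesis
        by (intro exI[of _ "\<epsilon> (\<alpha> *\<^sub>R x) * c * \<epsilon> x"]) (simp add: abs_mult \<epsilon>(1) g_def sq)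
    qed
    show "\<exists>p q. \<bar>p\<bar> = 1 \<and> \<bar>q\<bar> = 1 \<and> g (x + y) = p *\<^sub>R g x + q *\<^sub>R g y"
      if xy: "lin_independent [x, y]" for x y
    proof -
      obtain p q where "\<bar>p\<bar> = 1" "\<bar>q\<bar> = 1" "\<phi> (x + y) = p *\<^sub>R \<phi> x + q *\<^sub>R \<phi> y"
        using signed_add_independent[OF xy n] by blast
      then show ?thesis
        by - (rule exI[of _ "\<epsilon> (x + y) * p * \<epsilon> x"], rule exI[of _ "\<epsilon> (x + y) * q * \<epsilon> y"],
            simp add: abs_mult \<epsilon>(1) g_def sq scaleR_add_right mult.assoc)
    qed
    show "lin_independent [g x, g y, g z]" if xyz: "lin_independent [x, y, z]" for x y z
      unfolding lin_independent_three_iff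
    proof (intro allI impI)
      have ind: "lin_independent [\<phi> x, \<phi> y, \<phi> z]" using lin_independent_map[OF xyz] n by simp
      fix r s t assume "r *\<^sub>R g x + s *\<^sub>R g y + t *\<^sub>R g z = 0"
      then have "r * \<epsilon> x = 0 \<and> s * \<epsilon> y = 0 \<and> t * \<epsilon> z = 0"
        using ind[unfolded lin_independent_three_iff, rule_format, of "r * \<epsilon> x" "s * \<epsilon> y" "t * \<epsilon> z"]
        by (simp add: g_def)
      then show "r = 0 \<and> s = 0 \<and> t = 0" using sq by (metis mult_eq_0_iff zero_neq_one)
    qed
    show "\<exists>z. lin_independent [x, y, z]" if xy: "lin_independent [x, y]" for x y :: 'a
    proof -
      obtain zs where zs: "length ([x, y] @ zs) = n" "lin_independent ([x, y] @ zs)"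
        using X.lin_independent_extend[OF xy] n by auto
      then obtain z zs' where "zs = z # zs'" using n by (cases zs) auto
      then have "lin_independent [x, y, z]"
        using zs(2) by (intro lin_independent_subset[OF zs(2)]) (auto simp: lin_dependent_def)
      then show ?thesis by blast
    qed
    show "e \<noteq> 0" by (rule e)
    show "g (\<alpha> *\<^sub>R e) = \<alpha> *\<^sub>R g e" for \<alpha> using \<epsilon>(2) ge by (simp add: g_def)
    show "\<exists>a. \<bar>a\<bar> = 1 \<and> g (e + x) = a *\<^sub>R (g e + g x)" if ex: "lin_independent [e, x]" for x
    proof -
      obtain a where "\<bar>a\<bar> = 1" "\<phi> (e + x) = a *\<^sub>R (\<phi> e + \<epsilon> x *\<^sub>R \<phi> x)" using \<epsilon>(3)[OF ex] by blast
      then show ?thesis unfolding ge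
        by (intro exI[of _ "\<epsilon> (e + x) * a"]) (simp add: abs_mult \<epsilon>(1) g_def)
    qed
  qed
  have "\<epsilon> x \<in> {- 1, 1}" for x using \<epsilon>(1)[of x] by (auto simp: abs_if split: if_splits)
  moreover have "linear (\<lambda>x. \<epsilon> x *\<^sub>R \<phi> x)" using linear_g by (simp add: g_def[abs_def])
  ultimately show ?thesis unfolding plus_minus_linear_def by blast
qed

end

theorem theorem1:
  fixes n :: nat
    and nnormX :: "'a::real_vector list \<Rightarrow> real"
    and nnormY :: "'b::real_vector list \<Rightarrow> real"
    and \<phi> :: "'a \<Rightarrow> 'b"
  assumes "n \<ge> 3"
    and "n_normed_space n nnormX"
    and "n_normed_space n nnormY"
    and "\<And>xs. length xs = n \<Longrightarrow> nnormX xs = nnormY (map \<phi> xs)"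
  shows "plus_minus_linear \<phi>"
proof -
  interpret n_norm_preserving n nnormX nnormY \<phi>
    using assms by (simp add: n_norm_preserving_def n_norm_preserving_axioms_def)
  show ?thesis using assms(1) by (rule \<phi>_plus_minus_linear)
qed

end
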